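(* For a positive integer $t$, let $d_t$ be the natural density of the set of positive integers $n$ such that $t$ is a sum of distinct divisors of $n$, and let $\nu_t$ be the natural density of the set of positive integers $n$ such that every integer in $[1,t]$ is a sum of distinct divisors of $n$. There is an absolute constant $\beta_0>0$ such that, for all sufficiently large $X$, \[ \frac1X\sum_{X\le t<2X}(d_t-\nu_t)\ge\frac{\beta_0}{\log X}, \] where $t$ runs over integers. Moreover, the set of positive integers $t$ with $(\log t)(d_t-\nu_t)\ge\beta_0/2$ has lower density $1$.
   Context: $\log$ is the natural logarithm. The natural density of a set $A$ of positive integers is $\lim_{x\to\infty}\#(A\cap[1,x])/x$; the densities $d_t$ and $\nu_t$ exist for every $t$. The lower density of $A$ is $\liminf_{x\to\infty}\#(A\cap[1,x])/x$. *)

theory Defs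
  imports Complex_Main "HOL-Library.Extended_Real"
begin

definition count_upto :: "nat set \<Rightarrow> real \<Rightarrow> nat" where
  "count_upto A x = card {n \<in> A. 1 \<le> n \<and> real n \<le> x}"

(* Lim is a definite description, so this value is only meaningful when the limit exists. *)
definition natural_density :: "nat set \<Rightarrow> real" where
  "natural_density A = Lim at_top (\<lambda>x::real. real (count_upto A x) / x)"

definition lower_density :: "nat set \<Rightarrow> ereal" where
  "lower_density A = Liminf at_top (\<lambda>x::real. ereal (real (count_upto A x) / x))"

definition sum_of_distinct_divisors :: "nat \<Rightarrow> nat \<Rightarrow> bool" where
  "sum_of_distinct_divisors n t \<longleftrightarrow> (\<exists>D. finite D \<and> D \<subseteq> {d. d dvd n} \<and> \<Sum>D = t)"

definition d_dens :: "nat \<Rightarrow> real" where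
  "d_dens t = natural_density {n. n > 0 \<and> sum_of_distinct_divisors n t}"

definition nu_dens :: "nat \<Rightarrow> real" where
  "nu_dens t = natural_density {n. n > 0 \<and> (\<forall>m\<in>{1..t}. sum_of_distinct_divisors n m)}"

end

theory Submission
  imports Defs "HOL-Number_Theory.Cong"
begin

text \<open>For all large \<open>t\<close> we bound below by \<open>c / ln t\<close> the density of odd \<open>n\<close> for which \<open>t\<close> is a sum
  of distinct divisors; for such \<open>n\<close> the number 2 is not such a sum. If all of \<open>[3, B]\<close> are sums of
  distinct divisors of \<open>d\<close> and \<open>p\<close> is a prime with \<open>3 p + 2 \<le> B\<close> not dividing \<open>d\<close>, then all of
  \<open>[3, p B]\<close> are sums of distinct divisors of \<open>p d\<close>. Start from \<open>d = 315 * 3 ^ j\<close>, run through the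
  primes \<open>p\<close> in increasing order and multiply \<open>B\<close> by \<open>p\<close> whenever \<open>p\<close> divides the random integer
  \<open>n\<close>. As \<open>p\<close> divides \<open>n\<close> with probability \<open>1 / p\<close>, the quantity \<open>ln B - (\<Sum>p. ln p / p)\<close> is a
  martingale. By the lower bound in Mertens' first theorem the next prime is admissible while this
  quantity stays above a constant, and when \<open>B\<close> first reaches \<open>t\<close> it is at most \<open>2 ln t\<close>. Optional
  stopping therefore shows that \<open>B\<close> reaches \<open>t\<close> with probability at least \<open>c / ln t\<close>.\<close>

subsection \<open>A lower bound in Mertens' first theorem\<close>

text \<open>Recursive form of Legendre's formula. Passing from \<open>n\<close> to
  \<open>Suc n\<close> changes either side only if \<open>Suc n = p * j\<close>; this factor
  contributes one \<open>p\<close> plus those of \<open>j\<close>, and \<open>j\<close> is the new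
  factor in the factorial on the right.\<close>

lemma multiplicity_fact_div:
  fixes p :: nat
  assumes "prime p"
  shows "multiplicity p (fact n :: nat) = n div p + multiplicity p (fact (n div p) :: nat)"
proof (induction n)
  case 0
  then show ?case by simp
next
  case (Suc n)
  have p: "prime_elem p" "p > 0" using assms by (auto simp: prime_gt_0_nat)
  have step: "multiplicity p (fact (Suc k) :: nat) = multiplicity p (Suc k) + multiplicity p (fact k :: nat)" for k
    using p by (simp only: fact_Suc of_nat_id) (subst prime_elem_multiplicity_mult_distrib, auto)
  show ?case
  proof (cases "p dvd Suc n")
    case True
    then obtain j where j: "Suc n = p * j" by blast
    have j0: "j > 0" using j by (cases j) auto
    have d: "Suc n div p = Suc (n div p)"
      using True by (metis div_Suc dvd_imp_mod_0)
    have e: "Suc (n div p) = j" using d j p by simp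
    have "multiplicity p (Suc n) = Suc (multiplicity p j)"
      unfolding j using p j0 by (subst prime_elem_multiplicity_mult_distrib) (auto simp: multiplicity_self[of p])
    then show ?thesis
      unfolding d step using Suc e by simp
  next
    case False
    then have d: "Suc n div p = n div p"
      by (metis div_Suc dvd_eq_mod_eq_0)
    show ?thesis
      unfolding d step using False Suc by (simp add: not_dvd_imp_multiplicity_0)
  qed
qed

text \<open>With \<open>q = n div p\<close>, the recursion and the bound for \<open>q\<close> give
  at most \<open>(p - 1) * q + q = p * q \<le> n\<close>.\<close>

lemma multiplicity_fact_le:
  fixes p :: nat
  assumes "prime p"
  shows "(p - 1) * multiplicity p (fact n :: nat) \<le> n"
proof (induction n rule: less_induct)
  case (less n)
  have p: "p > 1" using assms prime_gt_1_nat by blast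
  show ?case
  proof (cases "n = 0")
    case False
    then have "n div p < n" using p by simp
    from less[OF this] have "(p - 1) * multiplicity p (fact n :: nat) \<le> (p - 1) * (n div p) + n div p"
      by (simp add: multiplicity_fact_div[OF assms, of n] algebra_simps)
    also have "\<dots> = p * (n div p)"
      using p by (cases p) auto
    also have "\<dots> \<le> n" by simp
    finally show ?thesis .
  qed simp
qed

text \<open>The easy half of Stirling's formula: from \<open>n\<close> to \<open>Suc n\<close> the
  right side grows by at most \<open>ln (Suc n)\<close>, because
  \<open>n * (ln (Suc n) - ln n) \<le> 1\<close>.\<close>

lemma ln_fact_ge: "ln (fact n :: real) \<ge> n * ln n - n"
proof (induction n)
  case (Suc n)
  show ?case
  proof (cases "n = 0")
    case False
    have "ln (1 + 1 / real n) \<le> 1 / real n" by (rule ln_add_one_self_le_self) simp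
    moreover have "1 + 1 / real n = real (Suc n) / real n" using False by (simp add: field_simps)
    ultimately have "ln (real (Suc n)) - ln (real n) \<le> 1 / real n"
      using False by (simp add: ln_div)
    then have "real n * (ln (real (Suc n)) - ln (real n)) \<le> 1"
      using False by (simp add: field_simps)
    moreover have "ln (fact (Suc n) :: real) = ln (real (Suc n)) + ln (fact n)"
      by (simp only: fact_Suc, subst ln_mult) auto
    ultimately show ?thesis using Suc by (simp add: algebra_simps)
  qed simp
qed simp

lemma ln_fact_eq_sum_multiplicity:
  "ln (fact n :: real) = (\<Sum>p | prime p \<and> p \<le> n. multiplicity p (fact n :: nat) * ln (real p))"
proof -
  have pf: "prime_factors (fact n :: nat) = {p. prime p \<and> p \<le> n}"
    by (auto simp: prime_factors_dvd prime_dvd_fact_iff)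
  have "(fact n :: nat) = (\<Prod>p\<in>prime_factors (fact n :: nat). p ^ multiplicity p (fact n :: nat))"
    by (rule prime_factorization_nat) simp
  then have "real (fact n) = (\<Prod>p | prime p \<and> p \<le> n. real p ^ multiplicity p (fact n :: nat))"
    unfolding pf by (metis (no_types, lifting) of_nat_power of_nat_prod prod.cong)
  then have "ln (fact n :: real) = ln (\<Prod>p | prime p \<and> p \<le> n. real p ^ multiplicity p (fact n :: nat))"
    by simp
  also have "\<dots> = (\<Sum>p | prime p \<and> p \<le> n. ln (real p ^ multiplicity p (fact n :: nat)))"
    by (rule ln_prod) (auto simp: prime_gt_0_nat)
  also have "\<dots> = (\<Sum>p | prime p \<and> p \<le> n. multiplicity p (fact n :: nat) * ln (real p))"
    by (intro sum.cong) (auto simp: ln_realpow prime_gt_0_nat)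
  finally show ?thesis .
qed

text \<open>The primitive of \<open>ln x / x\<^sup>2\<close> is \<open>- (ln x + 1) / x\<close>; replacing 1 by 2 makes the
  telescoping bound hold termwise.\<close>

lemma sum_ln_div_le:
  "N \<ge> 1 \<Longrightarrow> (\<Sum>n=2..N. ln (real n) / (real n * (real n - 1))) \<le> 2 - (ln (real N) + 2) / real N"
proof (induction N rule: nat_induct_at_least)
  case (Suc n)
  have n: "real n > 0" using Suc.hyps by simp
  have "ln (1 + 1 / real n) \<le> 1 / real n" by (rule ln_add_one_self_le_self) simp
  moreover have "1 + 1 / real n = real (Suc n) / real n" using n by (simp add: field_simps)
  ultimately have "ln (real (Suc n)) - ln (real n) \<le> 1 / real n"
    using n by (simp add: ln_div)
  then have "real (Suc n) * (ln (real (Suc n)) - ln (real n)) \<le> real (Suc n) * (1 / real n)"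
    by (intro mult_left_mono) auto
  also have "\<dots> \<le> 2" using Suc.hyps by (simp add: field_simps)
  finally have "ln (real (Suc n)) \<le> real (Suc n) * (ln (real n) + 2) - real n * (ln (real (Suc n)) + 2)"
    by (simp add: algebra_simps)
  then have "ln (real (Suc n)) / (real (Suc n) * real n)
      \<le> (real (Suc n) * (ln (real n) + 2) - real n * (ln (real (Suc n)) + 2)) / (real (Suc n) * real n)"
    using n by (intro divide_right_mono) auto
  also have "\<dots> = (ln (real n) + 2) / real n - (ln (real (Suc n)) + 2) / real (Suc n)"
    using n by (simp add: diff_divide_distrib del: of_nat_Suc)
  finally show ?case using Suc by simp
qed simp

text \<open>Compare the lower bound for \<open>ln (fact N)\<close> with its prime factorization, in
  which \<open>p\<close> has exponent at most \<open>N / (p - 1)\<close>. The constant 3 is 1 from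
  Stirling plus 2 for replacing \<open>1 / (p - 1)\<close> by \<open>1 / p\<close>; the latter error
  is summed over all integers from 2 on.\<close>

lemma sum_ln_over_primes_ge:
  assumes "N \<ge> 1"
  shows "(\<Sum>p | prime p \<and> p \<le> N. ln (real p) / real p) \<ge> ln (real N) - 3"
proof -
  let ?P = "{p::nat. prime p \<and> p \<le> N}"
  have split: "ln (real p) / (real p - 1) = ln (real p) / real p + ln (real p) / (real p * (real p - 1))"
    if "p \<in> ?P" for p
  proof -
    have "real p > 1" using that prime_gt_1_nat by auto
    then show ?thesis by (simp add: field_simps)
  qed
  have "real N * ln (real N) - real N \<le> (\<Sum>p\<in>?P. multiplicity p (fact N :: nat) * ln (real p))"
    using ln_fact_ge[of N] ln_fact_eq_sum_multiplicity[of N] by simp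
  also have "\<dots> \<le> (\<Sum>p\<in>?P. real N / (real p - 1) * ln (real p))"
  proof (rule sum_mono)
    fix p assume p: "p \<in> ?P"
    then have p1: "p > 1" using prime_gt_1_nat by auto
    have "real ((p - 1) * multiplicity p (fact N :: nat)) \<le> real N"
      using multiplicity_fact_le[of p N] p of_nat_mono by blast
    then have "real (multiplicity p (fact N :: nat)) \<le> real N / (real p - 1)"
      using p1 by (simp add: field_simps of_nat_diff)
    then show "multiplicity p (fact N :: nat) * ln (real p) \<le> real N / (real p - 1) * ln (real p)"
      using p1 by (intro mult_right_mono) auto
  qed
  also have "\<dots> = real N * (\<Sum>p\<in>?P. ln (real p) / (real p - 1))"
    by (simp add: sum_distrib_left)
  finally have "real N * (ln (real N) - 1) \<le> real N * (\<Sum>p\<in>?P. ln (real p) / (real p - 1))"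
    by (simp add: algebra_simps)
  then have "ln (real N) - 1 \<le> (\<Sum>p\<in>?P. ln (real p) / (real p - 1))"
    using assms by simp
  also have "\<dots> = (\<Sum>p\<in>?P. ln (real p) / real p) + (\<Sum>p\<in>?P. ln (real p) / (real p * (real p - 1)))"
    unfolding sum.distrib[symmetric] by (intro sum.cong split) auto
  also have "(\<Sum>p\<in>?P. ln (real p) / (real p * (real p - 1))) \<le> (\<Sum>n=2..N. ln (real n) / (real n * (real n - 1)))"
    by (rule sum_mono2) (auto simp: prime_ge_2_nat)
  also have "\<dots> \<le> 2"
  proof -
    have "(ln (real N) + 2) / real N \<ge> 0" using assms by simp
    with sum_ln_div_le[OF assms] show ?thesis by linarith
  qed
  finally show ?thesis by simp
qed

subsection \<open>Sums of distinct divisors\<close>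

lemma sum_of_distinct_divisors_dvd:
  assumes "sum_of_distinct_divisors m t" "m dvd n"
  shows "sum_of_distinct_divisors n t"
proof -
  have "{d. d dvd m} \<subseteq> {d. d dvd n}" using assms(2) dvd_trans by blast
  moreover obtain D where "finite D" "D \<subseteq> {d. d dvd m}" "\<Sum>D = t"
    using assms(1) unfolding sum_of_distinct_divisors_def by blast
  ultimately show ?thesis unfolding sum_of_distinct_divisors_def by blast
qed

text \<open>The divisors used for \<open>x\<close> divide \<open>c\<close> and so are not multiples
  of \<open>p\<close>, whereas those used for \<open>y\<close> are multiplied by \<open>p\<close>;
  hence no divisor occurs twice. Keeping \<open>c\<close> apart from \<open>e\<close> allows
  \<open>e\<close> itself to be divisible by \<open>p\<close>.\<close>

lemma sum_of_distinct_divisors_mult_prime: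
  assumes "\<not> p dvd c" "c dvd e" "p > 0"
    and "sum_of_distinct_divisors c x" "sum_of_distinct_divisors e y"
  shows "sum_of_distinct_divisors (e * p) (x + p * y)"
proof -
  obtain D where D: "finite D" "D \<subseteq> {d. d dvd c}" "\<Sum>D = x"
    using assms(4) unfolding sum_of_distinct_divisors_def by blast
  obtain E where E: "finite E" "E \<subseteq> {d. d dvd e}" "\<Sum>E = y"
    using assms(5) unfolding sum_of_distinct_divisors_def by blast
  have disj: "D \<inter> (*) p ` E = {}"
    using D(2) assms(1) by (auto dest: dvd_mult_left)
  have "\<Sum>((*) p ` E) = (\<Sum>d\<in>E. p * d)"
    using \<open>p > 0\<close> by (subst sum.reindex) (auto simp: inj_on_def)
  also have "\<dots> = p * y"
    unfolding E(3)[symmetric] by (rule sum_distrib_left[symmetric])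
  finally have "\<Sum>((*) p ` E) = p * y" .
  moreover have "\<Sum>(D \<union> (*) p ` E) = \<Sum>D + \<Sum>((*) p ` E)"
    using D(1) E(1) disj by (intro sum.union_disjoint) auto
  ultimately have "\<Sum>(D \<union> (*) p ` E) = x + p * y"
    using D(3) by simp
  moreover have "D \<union> (*) p ` E \<subseteq> {d. d dvd e * p}"

  proof (intro Un_least subsetI)
    fix d assume "d \<in> D"
    then show "d \<in> {d. d dvd e * p}"
      using D(2) assms(2) by (metis dvd_mult2 dvd_trans mem_Collect_eq subsetD)
  next
    fix d assume "d \<in> (*) p ` E"
    then show "d \<in> {d. d dvd e * p}"
      using E(2) by (auto simp: mult.commute[of _ p] intro: mult_dvd_mono)
  qed
  ultimately show ?thesis
    unfolding sum_of_distinct_divisors_def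
    using D(1) E(1) by (intro exI[of _ "D \<union> (*) p ` E"] conjI) auto
qed

text \<open>For \<open>x > B\<close> write \<open>x = r + p * y\<close>. Shifting the residue gives
  \<open>3 \<le> r \<le> p + 2\<close>, and \<open>3 * p + 2 \<le> B\<close> ensures both
  \<open>r \<le> B\<close> and \<open>y \<ge> 3\<close>, so \<open>r\<close> and \<open>y\<close>
  lie in the interval already covered.\<close>

lemma sums_interval_mult_prime:
  assumes "\<And>x. 3 \<le> x \<Longrightarrow> x \<le> B \<Longrightarrow> sum_of_distinct_divisors d x"
    and "\<not> p dvd d" "p > 0" "3 * p + 2 \<le> B" "3 \<le> x" "x \<le> p * B"
  shows "sum_of_distinct_divisors (d * p) x"
proof (cases "x \<le> B")
  case True
  then show ?thesis
    using assms(1)[OF assms(5)] by (auto intro: sum_of_distinct_divisors_dvd)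
next
  case False
  define y where "y = (x - 3) div p"
  define r where "r = (x - 3) mod p + 3"
  have x: "x = r + p * y" using assms(5) by (simp add: r_def y_def)
  have "r \<ge> 3" "r < p + 3" using assms(3) by (auto simp: r_def)
  have "3 * p \<le> x - 3" using False assms(4) by linarith
  then have "3 \<le> y" unfolding y_def using assms(3) by (simp add: less_eq_div_iff_mult_less_eq)
  moreover have "p * y \<le> p * B" using x assms(6) by linarith
  then have "y \<le> B" using assms(3) by simp
  moreover have "r \<le> B" using \<open>r < p + 3\<close> assms(3,4) by linarith
  ultimately show ?thesis
    unfolding x using assms(1-3) \<open>r \<ge> 3\<close> by (intro sum_of_distinct_divisors_mult_prime[where c = d]) auto
qed

text \<open>The divisors 1, 3, 5, 7, 9 have total 25. Their subset sums miss 2 and, by complement,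
  23, which explains both ends of the interval. All 32 subsets are enumerated.\<close>

lemma sums_interval_315:
  assumes "3 \<le> x" "x \<le> 22"
  shows "sum_of_distinct_divisors 315 x"
proof -
  have "\<forall>x\<in>set [3..<23]. x \<in> set (map sum_list (subseqs [1, 3, 5, 7, 9 :: nat]))"
    by code_simp
  moreover have "x \<in> set [3..<23]" using assms unfolding set_upt by simp
  ultimately have "x \<in> sum_list ` set (subseqs [1, 3, 5, 7, 9 :: nat])"
    unfolding list.set_map[symmetric] by (rule bspec)
  then obtain l where l: "l \<in> set (subseqs [1, 3, 5, 7, 9 :: nat])" "sum_list l = x"
    by (rule imageE) simp
  have "distinct l" using l(1) by (rule subseqs_distinctD) simp
  then have "\<Sum>(set l) = x" using l(2) sum_list_distinct_conv_sum_set[of l "\<lambda>x. x"] by simp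
  moreover have "set l \<subseteq> {1, 3, 5, 7, 9}"
    using imageI[OF l(1), of set] unfolding subseqs_powset by simp
  then have "set l \<subseteq> {d. d dvd 315}" by (rule order_trans) auto
  ultimately show ?thesis
    unfolding sum_of_distinct_divisors_def by blast
qed

text \<open>This provides odd starting numbers with an arbitrarily long interval and no prime factor
  above 7. Although 3 divides 315, a factor 3 still triples the interval: the divisors 1 and 5 of 35
  give the sums 0, 1, 5, which represent all residues modulo 3.\<close>

lemma sums_interval_315_pow3:
  "3 \<le> x \<Longrightarrow> x \<le> 22 * 3 ^ k \<Longrightarrow> sum_of_distinct_divisors (315 * 3 ^ k) x"
proof (induction k arbitrary: x)
  case 0
  then show ?case using sums_interval_315 by simp
next
  case (Suc k)
  show ?case
  proof (cases "x \<le> 22")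
    case True
    then show ?thesis
      using sums_interval_315[OF Suc.prems(1)] by (auto intro: sum_of_distinct_divisors_dvd)
  next
    case False
    obtain r y where r: "r \<in> {0, 1, 5}" and x: "x = r + 3 * y"
    proof -
      have x: "x = 3 * (x div 3) + x mod 3" by simp
      consider "x mod 3 = 0" | "x mod 3 = 1" | "x mod 3 = 2" by linarith
      then show ?thesis
      proof cases
        case 1
        then show ?thesis using x that[of 0 "x div 3"] by simp
      next
        case 2
        then show ?thesis using x that[of 1 "x div 3"] by simp
      next
        case 3
        then have "x = 5 + 3 * (x div 3 - 1)" using x False by linarith
        then show ?thesis using that[of 5 "x div 3 - 1"] by simp
      qed
    qed
    have "sum_of_distinct_divisors (35 :: nat) (\<Sum>D)" if "D \<in> {{}, {1}, {5}}" for D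
      unfolding sum_of_distinct_divisors_def using that by (intro exI[of _ D]) auto
    from this[of "{}"] this[of "{1}"] this[of "{5}"] r have "sum_of_distinct_divisors 35 r" by auto
    moreover have "sum_of_distinct_divisors (315 * 3 ^ k) y"
      using Suc.prems False r x by (intro Suc.IH) auto
    ultimately have "sum_of_distinct_divisors (315 * 3 ^ k * 3) (r + 3 * y)"
      by (intro sum_of_distinct_divisors_mult_prime[where c = 35]) auto
    then show ?thesis by (simp add: x mult_ac)
  qed
qed

lemma not_sum_of_distinct_divisors_odd_2:
  assumes "odd n"
  shows "\<not> sum_of_distinct_divisors n 2"
proof
  assume "sum_of_distinct_divisors n 2"
  then obtain D where D: "finite D" "D \<subseteq> {d. d dvd n}" "\<Sum>D = 2"
    unfolding sum_of_distinct_divisors_def by blast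
  have "D \<subseteq> {1}"
  proof
    fix d assume "d \<in> D"
    then have "odd d" "d \<le> 2" using D assms dvd_trans member_le_sum[of d D "\<lambda>x. x"] by auto
    then show "d \<in> {1}" by (cases "d = 2") (auto elim: oddE)
  qed
  then have "\<Sum>D \<le> \<Sum>{1::nat}" by (intro sum_mono2) auto
  with D show False by simp
qed

text \<open>Only divisors in \<open>[1, m]\<close> can contribute to a sum equal to
  \<open>m\<close>, and these divide \<open>n + N\<close> exactly when they divide
  \<open>n\<close>.\<close>

lemma sum_of_distinct_divisors_add:
  assumes "\<And>d. 0 < d \<Longrightarrow> d \<le> m \<Longrightarrow> d dvd N"
  shows "sum_of_distinct_divisors (n + N) m \<longleftrightarrow> sum_of_distinct_divisors n m"
proof -
  have *: "sum_of_distinct_divisors b m"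
    if a: "sum_of_distinct_divisors a m"
      and b: "\<And>d. 0 < d \<Longrightarrow> d \<le> m \<Longrightarrow> d dvd a \<Longrightarrow> d dvd b" for a b
  proof -
    obtain D where D: "finite D" "D \<subseteq> {d. d dvd a}" "\<Sum>D = m"
      using a unfolding sum_of_distinct_divisors_def by blast
    \<comment> \<open>If \<open>a = 0\<close>, the set \<open>D\<close> may contain 0; removing it
      leaves the sum unchanged.\<close>
    have "D - {0} \<subseteq> {d. d dvd b}"
    proof (intro subsetI CollectI)
      fix d assume d: "d \<in> D - {0}"
      then have "d \<le> m" using D(1,3) member_le_sum[of d D "\<lambda>x. x"] by simp
      then show "d dvd b" using d D(2) by (intro b) auto
    qed
    moreover have "\<Sum>(D - {0}) = m" using D(1,3) by (simp add: sum_diff1_nat)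
    ultimately show ?thesis
      unfolding sum_of_distinct_divisors_def using D(1) by (intro exI[of _ "D - {0}"] conjI) auto
  qed
  have dvd: "d dvd n + N \<longleftrightarrow> d dvd n" if "0 < d" "d \<le> m" for d
    using assms[OF that] by (simp add: dvd_add_left_iff)
  show ?thesis
  proof
    assume "sum_of_distinct_divisors (n + N) m"
    then show "sum_of_distinct_divisors n m" by (rule *) (simp add: dvd)
  next
    assume "sum_of_distinct_divisors n m"
    then show "sum_of_distinct_divisors (n + N) m" by (rule *) (simp add: dvd)
  qed
qed

subsection \<open>Densities of periodic sets\<close>

lemma periodic_mod:
  fixes A :: "nat set"
  assumes "\<And>n. n + M \<in> A \<longleftrightarrow> n \<in> A"
  shows "n mod M \<in> A \<longleftrightarrow> n \<in> A"
proof -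
  have "n + k * M \<in> A \<longleftrightarrow> n \<in> A" for n k
    by (induction k) (use assms in \<open>auto simp: add.assoc[symmetric] add.commute[of M]\<close>)
  from this[of "n mod M" "n div M"] show ?thesis by simp
qed

lemma card_periodic:
  fixes A :: "nat set"
  assumes "\<And>n. n + M \<in> A \<longleftrightarrow> n \<in> A"
  shows "card {n \<in> A. n < k * M} = k * card {n \<in> A. n < M}"
proof (induction k)
  case (Suc k)
  have shift: "n + k * M \<in> A \<longleftrightarrow> n \<in> A" for n k
    using periodic_mod[of M A, OF assms] by (metis mod_mult_self1)
  have "{n \<in> A. n < Suc k * M} = {n \<in> A. n < k * M} \<union> (\<lambda>n. n + k * M) ` {n \<in> A. n < M}"
  proof (intro equalityI subsetI)
    fix n assume n: "n \<in> {n \<in> A. n < Suc k * M}"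
    show "n \<in> {n \<in> A. n < k * M} \<union> (\<lambda>n. n + k * M) ` {n \<in> A. n < M}"
    proof (cases "n < k * M")
      case False
      then have "n = (n - k * M) + k * M" by simp
      moreover have "n - k * M \<in> A" "n - k * M < M" using n False shift[of "n - k * M" k] by auto
      ultimately show ?thesis by blast
    qed (use n in auto)
  qed (auto simp: shift)
  moreover have "{n \<in> A. n < k * M} \<inter> (\<lambda>n. n + k * M) ` {n \<in> A. n < M} = {}" by auto
  ultimately have "card {n \<in> A. n < Suc k * M}
      = card {n \<in> A. n < k * M} + card ((\<lambda>n. n + k * M) ` {n \<in> A. n < M})"
    by (subst card_Un_disjoint[symmetric]) auto
  also have "card ((\<lambda>n. n + k * M) ` {n \<in> A. n < M}) = card {n \<in> A. n < M}"
    by (intro card_image) (auto simp: inj_on_def)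
  finally show ?case using Suc by simp
qed simp

text \<open>Divisibility by \<open>q\<close> is independent of an event of period \<open>M\<close>
  coprime to \<open>q\<close>: multiplication by \<open>q\<close> permutes the residues modulo
  \<open>M\<close>, so the multiples of \<open>q\<close> below \<open>M * q\<close> meet
  \<open>A\<close> as often as all the numbers below \<open>M\<close> do.\<close>

lemma card_periodic_multiples:
  fixes A :: "nat set"
  assumes per: "\<And>n. n + M \<in> A \<longleftrightarrow> n \<in> A" and "M > 0" "q > 0" "coprime q M" "M * q dvd N"
  shows "q * card {n \<in> A. q dvd n \<and> n < N} = card {n \<in> A. n < N}"
proof -
  let ?R = "{n \<in> A. n < M}"
  have bij: "bij_betw (\<lambda>j. q * j mod M) {..<M} {..<M}"
  proof -
    have inj: "inj_on (\<lambda>j. q * j mod M) {..<M}"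
    proof (rule inj_onI)
      fix i j assume ij: "i \<in> {..<M}" "j \<in> {..<M}" "q * i mod M = q * j mod M"
      then have "[q * i = q * j] (mod M)" by (simp add: cong_def)
      then have "[i = j] (mod M)" using \<open>coprime q M\<close> by (simp add: cong_mult_lcancel_nat)
      then show "i = j" using ij by (simp add: cong_def)
    qed
    then show ?thesis
      using \<open>M > 0\<close> by (intro bij_betw_imageI endo_inj_surj) auto
  qed
  have "{n \<in> A. q dvd n \<and> n < M * q} = (*) q ` {j. j < M \<and> q * j mod M \<in> A}"
    using \<open>q > 0\<close> by (auto simp: periodic_mod[of M A, OF per] mult.commute elim!: dvdE)
  then have "card {n \<in> A. q dvd n \<and> n < M * q} = card {j. j < M \<and> q * j mod M \<in> A}"
    using \<open>q > 0\<close> by (simp add: card_image inj_on_def)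
  also have "\<dots> = card ?R"
  proof (rule bij_betw_same_card)
    let ?f = "\<lambda>j. q * j mod M"
    have "inj_on ?f {j. j < M \<and> ?f j \<in> A}"
      using bij by (auto simp: bij_betw_def intro: inj_on_subset)
    moreover have "?f ` {j. j < M \<and> ?f j \<in> A} = ?R"
    proof (intro equalityI subsetI)
      fix n assume n: "n \<in> ?R"
      then have "n \<in> ?f ` {..<M}" using bij by (simp add: bij_betw_def)
      then show "n \<in> ?f ` {j. j < M \<and> ?f j \<in> A}" using n by blast
    qed (use \<open>M > 0\<close> in auto)
    ultimately show "bij_betw ?f {j. j < M \<and> ?f j \<in> A} ?R"
      by (rule bij_betw_imageI)
  qed
  finally have R: "card {n \<in> A. q dvd n \<and> n < M * q} = card ?R" .
  obtain k where N: "N = k * (M * q)" using assms(5) by (metis dvdE mult.commute)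
  have "card {n \<in> {n \<in> A. q dvd n}. n < k * (M * q)} = k * card {n \<in> {n \<in> A. q dvd n}. n < M * q}"
  proof (rule card_periodic)
    fix n
    have "n + q * M \<in> A \<longleftrightarrow> n \<in> A"
      using periodic_mod[of M A, OF per] by (metis mod_mult_self1)
    then show "n + M * q \<in> {n \<in> A. q dvd n} \<longleftrightarrow> n \<in> {n \<in> A. q dvd n}"
      by (simp add: mult.commute)
  qed
  then have "card {n \<in> A. q dvd n \<and> n < N} = k * card ?R" using R N by (simp add: conj_assoc)
  moreover have "card {n \<in> A. n < N} = (k * q) * card ?R"
    using card_periodic[of M A "k * q", OF per] N by (simp add: mult_ac)
  ultimately show ?thesis by simp
qed

text \<open>Up to \<open>x\<close> there are about \<open>x / N\<close> full periods with
  \<open>c\<close> elements each. The incomplete period, the rounding and the excluded 0 cost an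
  error bounded independently of \<open>x\<close>, which vanishes after division by
  \<open>x\<close>.\<close>

lemma tendsto_count_upto_periodic:
  fixes A :: "nat set"
  assumes per: "\<And>n. n + N \<in> A \<longleftrightarrow> n \<in> A" and "N > 0"
  shows "((\<lambda>x. real (count_upto {n. n > 0 \<and> n \<in> A} x) / x) \<longlongrightarrow> real (card {n \<in> A. n < N}) / real N) at_top"
proof -
  define c where "c = card {n \<in> A. n < N}"
  have c: "c \<le> N" unfolding c_def using card_mono[of "{..<N}" "{n \<in> A. n < N}"] by auto
  have bounds: "c * (K div N) \<le> card {n \<in> A. n < K}" "card {n \<in> A. n < K} \<le> c * (K div N) + c" for K
  proof -
    have "(K div N) * c = card {n \<in> A. n < (K div N) * N}"
      unfolding c_def by (rule card_periodic[symmetric, OF per])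
    also have "\<dots> \<le> card {n \<in> A. n < K}"
      by (intro card_mono) (auto intro: less_le_trans[OF _ div_times_less_eq_dividend])
    finally show "c * (K div N) \<le> card {n \<in> A. n < K}" by (simp add: mult.commute)
    have "card {n \<in> A. n < K} \<le> card {n \<in> A. n < (Suc (K div N)) * N}"
      using dividend_less_div_times[OF \<open>N > 0\<close>, of K]
      by (intro card_mono) (auto simp: add.commute)
    also have "\<dots> = Suc (K div N) * c"
      unfolding c_def by (rule card_periodic[OF per])
    finally show "card {n \<in> A. n < K} \<le> c * (K div N) + c" by (simp add: algebra_simps)
  qed
  have cnt: "\<bar>real (count_upto {n. n > 0 \<and> n \<in> A} x) - c / N * x\<bar> \<le> 2 * N + 2" if "x \<ge> 0" for x
  proof -
    \<comment> \<open>The successor turns \<open>real n \<le> x\<close> into the strict bound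
      \<open>n < K\<close> used for periods.\<close>
    define K where "K = Suc (nat \<lfloor>x\<rfloor>)"
    have K: "real K - 1 \<le> x" "x < real K" unfolding K_def using that by linarith+
    have lt: "real n \<le> x \<longleftrightarrow> n < K" for n unfolding K_def using that by linarith
    have eq: "{n \<in> {n. n > 0 \<and> n \<in> A}. 1 \<le> n \<and> real n \<le> x} = {n \<in> A. n < K} - {0}"
      by (auto simp: lt)
    have "card {n \<in> A. n < K} - 1 \<le> count_upto {n. n > 0 \<and> n \<in> A} x"
      "count_upto {n. n > 0 \<and> n \<in> A} x \<le> card {n \<in> A. n < K}"
      unfolding count_upto_def eq using card_Diff1_le by (auto simp: card_Diff_singleton_if)
    with bounds[of K] have 1: "real (c * (K div N)) - 1 \<le> real (count_upto {n. n > 0 \<and> n \<in> A} x)"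
      "real (count_upto {n. n > 0 \<and> n \<in> A} x) \<le> real (c * (K div N) + c)"
      by linarith+
    have "real K < real (K div N * N + N)"
      using dividend_less_div_times[OF \<open>N > 0\<close>, of K] by (simp only: of_nat_less_iff add.commute)
    then have d: "real (K div N) \<le> K / N" "K / N \<le> real (K div N) + 1"
      using of_nat_div_le_of_nat[of K N] \<open>N > 0\<close> by (auto simp: field_simps)
    have cN: "0 \<le> c / N" "c / N \<le> 1" using c \<open>N > 0\<close> by auto
    have "c * real (K div N) \<le> c * (K / N)" using d by (intro mult_left_mono) auto
    moreover have "c * (K / N) = c / N * K" by simp
    moreover have "c / N * K \<le> c / N * (x + 1)" using K cN by (intro mult_left_mono) auto
    moreover have "c / N * x \<le> c / N * K" using K cN by (intro mult_left_mono) auto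
    moreover have "c * (K / N) \<le> c * (real (K div N) + 1)" using d by (intro mult_left_mono) auto
    moreover have "real c \<le> real N" using c by simp
    moreover have "c / N * (x + 1) = c / N * x + c / N" by (simp only: distrib_left mult_1_right)
    moreover have "c * (real (K div N) + 1) = c * real (K div N) + c" by (simp add: algebra_simps)
    moreover have "real (c * (K div N)) = c * real (K div N)"
      "real (c * (K div N) + c) = c * real (K div N) + c" by simp_all
    ultimately show ?thesis using 1 cN unfolding abs_le_iff by linarith
  qed
  have "((\<lambda>x. real (count_upto {n. n > 0 \<and> n \<in> A} x) / x - c / N) \<longlongrightarrow> 0) at_top"
  proof (rule tendsto_0_le[where K = 1])
    show "((\<lambda>x. (2 * real N + 2) / x) \<longlongrightarrow> 0) at_top"
      by (intro tendsto_divide_0[OF tendsto_const] filterlim_at_top_imp_at_infinity filterlim_ident)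
    show "\<forall>\<^sub>F x in at_top. norm (real (count_upto {n. n > 0 \<and> n \<in> A} x) / x - c / N) \<le> norm ((2 * real N + 2) / x) * 1"
      using eventually_gt_at_top[of 0]
    proof eventually_elim
      case (elim x)
      have "real (count_upto {n. n > 0 \<and> n \<in> A} x) / x - c / N
          = (real (count_upto {n. n > 0 \<and> n \<in> A} x) - c / N * x) / x"
        using elim by (simp add: diff_divide_distrib)
      then show ?case
        using cnt[of x] elim by (simp add: divide_right_mono)
    qed
  qed
  then show ?thesis unfolding c_def by (subst (asm) LIM_zero_iff)
qed

lemma natural_density_periodic:
  fixes A :: "nat set"
  assumes "\<And>n. n + N \<in> A \<longleftrightarrow> n \<in> A" and "N > 0"
  shows "natural_density {n. n > 0 \<and> n \<in> A} = real (card {n \<in> A. n < N}) / real N"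
  unfolding natural_density_def
  by (rule tendsto_Lim[OF _ tendsto_count_upto_periodic[OF assms]]) auto

subsection \<open>Optional stopping\<close>

text \<open>The primes below 11 are spent on the odd starting number \<open>315 * 3 ^ j\<close>.\<close>

definition prime_ln_sum :: "nat \<Rightarrow> real" where
  "prime_ln_sum k = (\<Sum>p | prime p \<and> 11 \<le> p \<and> p < k. ln (real p) / real p)"

text \<open>Mertens' bound at \<open>k - 1\<close>, with the primes below 11 and the change from
  \<open>k - 1\<close> to \<open>5 * k\<close> absorbed into \<open>C\<close>. The factor 5 is there
  so that \<open>5 * k \<le> B\<close> will imply \<open>3 * k + 2 \<le> B\<close>.\<close>

lemma prime_ln_sum_ge: "\<exists>C. \<forall>k\<ge>11. prime_ln_sum k \<ge> ln (5 * real k) - C"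
proof (intro exI allI impI)
  fix k :: nat assume k: "11 \<le> k"
  let ?f = "\<lambda>p::nat. ln (real p) / real p"
  have "{p. prime p \<and> p \<le> k - 1} = {p. prime p \<and> p < 11} \<union> {p. prime p \<and> 11 \<le> p \<and> p < k}"
    using k by auto
  then have "(\<Sum>p | prime p \<and> p \<le> k - 1. ?f p) = (\<Sum>p | prime p \<and> p < 11. ?f p) + prime_ln_sum k"
    unfolding prime_ln_sum_def by (simp only:) (rule sum.union_disjoint, auto)
  moreover have "ln (real (k - 1)) - 3 \<le> (\<Sum>p | prime p \<and> p \<le> k - 1. ?f p)"
    using k by (intro sum_ln_over_primes_ge) auto
  moreover have "ln (5 * real k) \<le> ln (real (k - 1)) + ln 10"
  proof -
    have "ln (5 * real k) \<le> ln (real (k - 1) * 10)" using k by (subst ln_le_cancel_iff) auto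
    then show ?thesis using k by (subst (asm) ln_mult) auto
  qed
  ultimately show "prime_ln_sum k \<ge> ln (5 * real k) - (ln 10 + 3 + (\<Sum>p | prime p \<and> p < 11. ?f p))"
    by linarith
qed

text \<open>The optional stopping argument, as a backward induction over the primes from \<open>t\<close> down to
  \<open>k\<close>: the process is stopped as soon as \<open>t \<le> B\<close> (success) or \<open>ln B - C - prime_ln_sum k\<close> becomes
  negative (given up), and the lower bound on \<open>prime_ln_sum k\<close> makes \<open>k\<close> an admissible factor
  in all remaining cases.\<close>

lemma card_sum_of_distinct_divisors_ge:
  fixes A :: "nat set"
  assumes C: "\<And>k. k \<ge> 11 \<Longrightarrow> prime_ln_sum k \<ge> ln (5 * real k) - C"
    and k: "11 \<le> k" "k \<le> Suc t"
    and "0 < B" "B \<le> t ^ 2"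
    and "\<And>x. 3 \<le> x \<Longrightarrow> x \<le> B \<Longrightarrow> sum_of_distinct_divisors d x"
    and "\<And>n. n + M \<in> A \<longleftrightarrow> n \<in> A" "M > 0" "d dvd M" "\<And>n. n \<in> A \<Longrightarrow> d dvd n"
    and "\<And>p. prime p \<Longrightarrow> k \<le> p \<Longrightarrow> coprime p M"
    and "M * (\<Prod>p | prime p \<and> k \<le> p \<and> p \<le> t. p) dvd N"
  shows "(ln (real B) - C - prime_ln_sum k) * real (card {n \<in> A. n < N})
    \<le> 2 * ln (real t) * real (card {n \<in> A. sum_of_distinct_divisors n t \<and> n < N})"
  using k assms(4-)
\<comment> \<open>\<open>A\<close> is the event fixed by the primes below \<open>k\<close>,
  \<open>M\<close> a period of it, \<open>d\<close> the divisor collected so far and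
  \<open>B\<close> the end of its interval. All counts are taken over the same range
  \<open>N\<close>, a multiple of every period that arises.\<close>
proof (induction "Suc t - k" arbitrary: k A B d M rule: less_induct)
  case less
  note k = less.prems(1,2) and B = less.prems(3,4) and sums = less.prems(5) and per = less.prems(6)
    and M = less.prems(7,8) and A = less.prems(9) and cop = less.prems(10) and N = less.prems(11)
  define c where "c X = real (card {n \<in> X. n < N})" for X
  define s where "s X = real (card {n \<in> X. sum_of_distinct_divisors n t \<and> n < N})" for X
  have nonneg: "c X \<ge> 0" "s X \<ge> 0" for X by (simp_all add: c_def s_def)
  have t: "t \<ge> 10" using k by simp
  have kln: "ln (5 * real k) \<le> C + prime_ln_sum k" using C[OF k(1)] by linarith
  have "(ln (real B) - C - prime_ln_sum k) * c A \<le> 2 * ln (real t) * s A"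
  proof -
    consider "ln (real B) < C + prime_ln_sum k" | "t \<le> B"
      | "C + prime_ln_sum k \<le> ln (real B)" "B < t" by linarith
    then show ?thesis
    proof cases
      case 1
      then have "(ln (real B) - C - prime_ln_sum k) * c A \<le> 0"
        using nonneg by (intro mult_nonpos_nonneg) auto
      also have "0 \<le> 2 * ln (real t) * s A" using t nonneg by (intro mult_nonneg_nonneg) auto
      finally show ?thesis .
    next
      \<comment> \<open>Success: every element of \<open>A\<close> counts. The factor on the left is
        at most \<open>ln B\<close>, as \<open>C + prime_ln_sum k\<close> is at least
        \<open>ln (5 * k)\<close> and so nonnegative.\<close>
      case 2
      have "sum_of_distinct_divisors n t" if "n \<in> A" for n
        using sums[of t] 2 t A[OF that] by (auto intro: sum_of_distinct_divisors_dvd)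
      then have "s A = c A" unfolding s_def c_def by (metis (no_types, lifting))
      moreover have "ln (real B) - C - prime_ln_sum k \<le> 2 * ln (real t)"
      proof -
        have "ln (real B) \<le> ln (real t ^ 2)"
          using B t by (subst ln_le_cancel_iff) (auto simp flip: of_nat_power)
        also have "\<dots> = 2 * ln (real t)" using t by (simp add: ln_realpow)
        finally have "ln (real B) \<le> 2 * ln (real t)" .
        moreover have "0 \<le> ln (5 * real k)" using k by simp
        ultimately show ?thesis using kln by linarith
      qed
      ultimately show ?thesis using nonneg by (auto intro: mult_right_mono)
    next
      case 3
      have "ln (5 * real k) \<le> ln (real B)" using kln 3 by linarith
      \<comment> \<open>This is used twice: it makes \<open>k\<close> admissible as a factor, and
        with \<open>B < t\<close> it shows that the range of primes up to \<open>t\<close> is not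
        yet exhausted.\<close>
      then have kB: "5 * k \<le> B" using k B by (subst (asm) ln_le_cancel_iff) auto
      then have kt: "k \<le> t" using 3 k by linarith
      have le: "11 \<le> Suc k" "Suc k \<le> Suc t" and dec: "Suc t - Suc k < Suc t - k" using k kt by auto
      show ?thesis
      proof (cases "prime k")
        case False
        have "{p. prime p \<and> 11 \<le> p \<and> p < Suc k} = {p. prime p \<and> 11 \<le> p \<and> p < k}"
          "{p. prime p \<and> k \<le> p \<and> p \<le> t} = {p. prime p \<and> Suc k \<le> p \<and> p \<le> t}"
          using False by (auto simp: less_Suc_eq Suc_le_eq order_le_less)
        then have "prime_ln_sum (Suc k) = prime_ln_sum k"
          and "M * (\<Prod>p | prime p \<and> Suc k \<le> p \<and> p \<le> t. p) dvd N"
          using N by (auto simp: prime_ln_sum_def)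
        moreover have "\<And>p. prime p \<Longrightarrow> Suc k \<le> p \<Longrightarrow> coprime p M" using cop by simp
        ultimately show ?thesis
          using less.hyps[OF dec le B sums per M A] unfolding c_def s_def by simp
      next
        case True
        define A1 where "A1 = {n \<in> A. k dvd n}"
        define A0 where "A0 = {n \<in> A. \<not> k dvd n}"
        have sets: "{p. prime p \<and> 11 \<le> p \<and> p < Suc k} = insert k {p. prime p \<and> 11 \<le> p \<and> p < k}"
          "{p. prime p \<and> k \<le> p \<and> p \<le> t} = insert k {p. prime p \<and> Suc k \<le> p \<and> p \<le> t}"
          using True k kt by auto
        have sum_Suc: "prime_ln_sum (Suc k) = prime_ln_sum k + ln (real k) / real k"
          unfolding prime_ln_sum_def sets(1) by (subst sum.insert) auto
        have prod: "M * k * (\<Prod>p | prime p \<and> Suc k \<le> p \<and> p \<le> t. p) dvd N"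
          using N unfolding sets(2) by (subst (asm) prod.insert) (auto simp: mult.assoc)
        have cop': "coprime p (M * k)" if "prime p" "Suc k \<le> p" for p
          using cop[of p] that True by (auto simp: primes_coprime)
        have per': "n + M * k \<in> A \<longleftrightarrow> n \<in> A" for n
          using periodic_mod[of M A, OF per] by (metis mod_mult_self2)
        have perA1: "n + M * k \<in> A1 \<longleftrightarrow> n \<in> A1" and perA0: "n + M * k \<in> A0 \<longleftrightarrow> n \<in> A0" for n
          using per'[of n] unfolding A1_def A0_def by auto
        have "\<not> k dvd d"
          using M(2) cop[OF True order_refl] True dvd_trans not_prime_unit coprime_common_divisor
          by (metis dvd_refl)
        \<comment> \<open>Since \<open>B < t\<close> and \<open>k \<le> t\<close>, a single
          multiplication cannot overshoot \<open>t ^ 2\<close>; this is the source of the factor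
          \<open>2 * ln t\<close>.\<close>
        have kB2: "0 < k * B" "k * B \<le> t ^ 2"
          using k B 3 kt by (auto simp: power2_eq_square intro: mult_mono)
        have Mk: "M * k > 0" "d * k dvd M * k" "d dvd M * k" using M k by auto
        have sums': "sum_of_distinct_divisors (d * k) x" if "3 \<le> x" "x \<le> k * B" for x
          using sums_interval_mult_prime[OF sums \<open>\<not> k dvd d\<close>, of B x] that k kB by simp
        have A1: "d * k dvd n" if "n \<in> A1" for n
        proof -
          have "coprime d k" using \<open>\<not> k dvd d\<close> True by (metis coprime_commute prime_imp_coprime)
          then show ?thesis using that A unfolding A1_def by (auto intro: divides_mult)
        qed
        have A0: "d dvd n" if "n \<in> A0" for n using A that unfolding A0_def by blast
        have IH1: "(ln (real (k * B)) - C - prime_ln_sum (Suc k)) * c A1 \<le> 2 * ln (real t) * s A1"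
          unfolding c_def s_def by (rule less.hyps[OF dec le kB2 sums' perA1 Mk(1,2) A1 cop' prod])
        have IH0: "(ln (real B) - C - prime_ln_sum (Suc k)) * c A0 \<le> 2 * ln (real t) * s A0"
          unfolding c_def s_def by (rule less.hyps[OF dec le B sums perA0 Mk(1,3) A0 cop' prod])
        have "M * k dvd N" using prod by (rule dvd_mult_left)
        then have "k * card {n \<in> A. k dvd n \<and> n < N} = card {n \<in> A. n < N}"
          using k cop[OF True order_refl] by (intro card_periodic_multiples[OF per M(1)]) auto
        then have cA1: "c A = real k * c A1" unfolding c_def A1_def
          by (simp add: conj_assoc flip: of_nat_mult)
        have split: "card {n \<in> A. P n \<and> n < N} = card {n \<in> A1. P n \<and> n < N} + card {n \<in> A0. P n \<and> n < N}" for P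
        proof -
          have "{n \<in> A. P n \<and> n < N} = {n \<in> A1. P n \<and> n < N} \<union> {n \<in> A0. P n \<and> n < N}"
            unfolding A1_def A0_def by auto
          then show ?thesis
            by (simp only:) (rule card_Un_disjoint, auto simp: A1_def A0_def)
        qed
        have cA: "c A = c A1 + c A0" and sA: "s A = s A1 + s A0"
          using split[of "\<lambda>_. True"] split[of "\<lambda>n. sum_of_distinct_divisors n t"]
          unfolding c_def s_def by simp_all
        have lnkB: "ln (real (k * B)) = ln (real k) + ln (real B)"
          using k B by (simp add: ln_mult)
        \<comment> \<open>The martingale property: \<open>A1\<close> is exactly the fraction
          \<open>1 / k\<close> of \<open>A\<close>, so the gain \<open>ln k\<close> on
          \<open>A1\<close> balances the loss \<open>ln k / k\<close> on all of
          \<open>A\<close>.\<close>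
        have "ln (real k) / real k * c A = ln (real k) * c A1"
          unfolding cA1 using k by simp
        then have "(ln (real B) - C - prime_ln_sum k) * c A
          = (ln (real (k * B)) - C - prime_ln_sum (Suc k)) * c A1 + (ln (real B) - C - prime_ln_sum (Suc k)) * c A0"
          unfolding lnkB sum_Suc cA by (simp only: algebra_simps)
        then show ?thesis using IH1 IH0 unfolding sA by (simp only: distrib_left)
      qed
    qed
  qed
  then show ?case unfolding c_def s_def .
qed

section \<open>From counts over a period to the densities\<close>

text \<open>Both sets have period \<open>N\<close>, as every positive integer up to \<open>t\<close>
  divides \<open>fact t\<close>, and for \<open>t \<ge> 1\<close> the set behind
  \<open>nu_dens\<close> lies in the one behind \<open>d_dens\<close>. The difference of densities
  is thus the proportion of the set difference in one period.\<close>

lemma d_dens_minus_nu_dens_eq: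
  assumes "t \<ge> 1" "N > 0" "fact t dvd N"
  shows "d_dens t - nu_dens t = real (card {n. sum_of_distinct_divisors n t \<and>
    \<not> (\<forall>m\<in>{1..t}. sum_of_distinct_divisors n m) \<and> n < N}) / real N"
proof -
  define E where "E = {n. sum_of_distinct_divisors n t}"
  define V where "V = {n. \<forall>m\<in>{1..t}. sum_of_distinct_divisors n m}"
  have per: "sum_of_distinct_divisors (n + N) m \<longleftrightarrow> sum_of_distinct_divisors n m" if "m \<le> t" for m n
  proof (rule sum_of_distinct_divisors_add)
    fix d assume "0 < d" "d \<le> m"
    then have "d dvd fact t" using that by (intro dvd_fact) auto
    then show "d dvd N" using assms(3) by (rule dvd_trans)
  qed
  have "V \<subseteq> E" using assms(1) by (auto simp: V_def E_def)
  have "d_dens t = real (card {n \<in> E. n < N}) / real N"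
    unfolding d_dens_def using natural_density_periodic[of N E] per[of t] \<open>N > 0\<close> by (simp add: E_def)
  moreover have "nu_dens t = real (card {n \<in> V. n < N}) / real N"
    unfolding nu_dens_def using natural_density_periodic[of N V] per \<open>N > 0\<close> by (simp add: V_def)
  moreover have "real (card ({n \<in> E. n < N} - {n \<in> V. n < N})) = real (card {n \<in> E. n < N}) - real (card {n \<in> V. n < N})"
    using \<open>V \<subseteq> E\<close> by (subst card_Diff_subset) (auto intro!: of_nat_diff card_mono)
  moreover have "{n \<in> E. n < N} - {n \<in> V. n < N} = {n. sum_of_distinct_divisors n t \<and>
      \<not> (\<forall>m\<in>{1..t}. sum_of_distinct_divisors n m) \<and> n < N}"
    by (auto simp: E_def V_def)
  ultimately show ?thesis by (simp add: diff_divide_distrib)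
qed

lemma d_dens_minus_nu_dens_ge:
  "\<exists>c>0. \<forall>\<^sub>F t in sequentially. c / ln (real t) \<le> d_dens t - nu_dens t"
proof -
  obtain C where C: "\<And>k. k \<ge> 11 \<Longrightarrow> prime_ln_sum k \<ge> ln (5 * real k) - C"
    using prime_ln_sum_ge by blast
  \<comment> \<open>A large power of 3 makes the initial value \<open>ln B - C\<close> of the
    martingale at least 1; \<open>prime_ln_sum 11\<close> is 0.\<close>
  obtain j where j: "exp (C + 1) < 3 ^ j" using real_arch_pow[of 3 "exp (C + 1)"] by auto
  define B :: nat where "B = 22 * 3 ^ j"
  define m :: nat where "m = 315 * 3 ^ j"
  define M where "M = 2 * m"
  \<comment> \<open>These are the odd multiples of \<open>m\<close>, written as one residue class
    modulo \<open>2 * m\<close>.\<close>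
  define A where "A = {n. n mod M = m}"
  have "exp (C + 1) \<le> 22 * 3 ^ j" by (rule order_trans[OF less_imp_le[OF j]]) simp
  then have "exp (C + 1) \<le> real B" by (simp add: B_def)
  then have B: "ln (real B) \<ge> C + 1" "B > 0"
    by (subst ln_ge_iff) (auto simp: B_def)
  have m: "odd m" "m > 0" "M > 0" by (auto simp: m_def M_def)
  have dvd: "m dvd n" and odd: "odd n" if "n \<in> A" for n
  proof -
    have "n = m * (2 * (n div M) + 1)"
      using that div_mult_mod_eq[of n M] by (simp add: A_def M_def algebra_simps)
    then obtain q where n: "n = m * (2 * q + 1)" ..
    show "m dvd n" "odd n" unfolding n using m(1) by auto
  qed
  have "1 / (2 * real M) / ln (real t) \<le> d_dens t - nu_dens t" if t: "t \<ge> 11 + B" for t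
  proof -
    \<comment> \<open>The factor \<open>fact t\<close> serves the density formula, the other one the
      optional stopping bound.\<close>
    define N where "N = fact t * (M * (\<Prod>p | prime p \<and> 11 \<le> p \<and> p \<le> t. p))"
    have N: "N > 0" "fact t dvd N" "M dvd N"
      using m by (auto simp: N_def prime_gt_0_nat intro!: prod_pos)
    have "prime_ln_sum 11 = 0" unfolding prime_ln_sum_def by (rule sum.neutral) auto
    have le: "(ln (real B) - C - prime_ln_sum 11) * real (card {n \<in> A. n < N})
      \<le> 2 * ln (real t) * real (card {n \<in> A. sum_of_distinct_divisors n t \<and> n < N})"
    proof (rule card_sum_of_distinct_divisors_ge[OF C, where d = m and M = M])
      show "B \<le> t ^ 2" using t by (simp add: power2_eq_square) (metis add_leD2 le_square le_trans)
      show "sum_of_distinct_divisors m x" if "3 \<le> x" "x \<le> B" for x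
        using that unfolding m_def B_def by (rule sums_interval_315_pow3)
      show "coprime p M" if p: "prime p" "11 \<le> p" for p
      proof -
        have "\<not> p dvd M"
        proof
          assume "p dvd M"
          then have "p dvd 2 * (3 * 3 * 5 * 7 * 3 ^ j)" by (simp add: M_def m_def)
          then have "p dvd 2 \<or> p dvd 3 \<or> p dvd 5 \<or> p dvd 7"
            using p(1) by (simp only: prime_dvd_mult_iff) (auto dest: prime_dvd_power)
          then have "p \<le> 7" by (auto dest!: dvd_imp_le)
          then show False using p(2) by simp
        qed
        then show ?thesis using p(1) by (rule prime_imp_coprime[rotated])
      qed
    qed (use t B m dvd in \<open>auto simp: A_def M_def N_def\<close>)
    have "card {n \<in> A. n < N} * M = N"
    proof -
      obtain k where k: "N = k * M" using N(3) by (metis dvdE mult.commute)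
      have "{n \<in> A. n < M} = {m}" using m by (auto simp: A_def M_def)
      then show ?thesis
        using card_periodic[of M A k] unfolding k by (simp add: A_def)
    qed
    then have "real N = real (card {n \<in> A. n < N}) * real M" by (metis of_nat_mult)
    then have "real N / real M = real (card {n \<in> A. n < N})"
      using m(3) by (metis nonzero_mult_div_cancel_right of_nat_eq_0_iff not_gr_zero)
    also have "\<dots> = 1 * real (card {n \<in> A. n < N})" by simp
    also have "\<dots> \<le> (ln (real B) - C - prime_ln_sum 11) * real (card {n \<in> A. n < N})"
      using B(1) \<open>prime_ln_sum 11 = 0\<close> by (intro mult_right_mono) auto
    also note le
    finally have cardN: "real N / real M
      \<le> 2 * ln (real t) * real (card {n \<in> A. sum_of_distinct_divisors n t \<and> n < N})"
      (is "_ \<le> _ * ?s") .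
    \<comment> \<open>Elements of \<open>A\<close> are odd, so the target 2, which lies in
      \<open>[1, t]\<close>, is not attained.\<close>
    have "{n \<in> A. sum_of_distinct_divisors n t \<and> n < N} \<subseteq> {n. sum_of_distinct_divisors n t \<and>
        \<not> (\<forall>m\<in>{1..t}. sum_of_distinct_divisors n m) \<and> n < N}" (is "_ \<subseteq> ?D")
      using odd not_sum_of_distinct_divisors_odd_2 t by fastforce
    then have "?s \<le> real (card ?D)" by (intro of_nat_mono card_mono) auto
    then have "2 * ln (real t) * ?s \<le> 2 * ln (real t) * real (card ?D)"
      using t by (intro mult_left_mono) auto
    with cardN have "real N / real M \<le> 2 * ln (real t) * real (card ?D)" by linarith
    moreover have "ln (real t) > 0" using t by simp
    ultimately have "1 / (2 * real M) / ln (real t) \<le> real (card ?D) / real N"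
      using N m by (simp add: field_simps)
    then show ?thesis using d_dens_minus_nu_dens_eq[of t N] t N by simp
  qed
  then show ?thesis
    using m by (intro exI[of _ "1 / (2 * real M)"]) (auto intro: eventually_sequentiallyI[of "11 + B"])
qed

section \<open>Averages over dyadic intervals and lower density\<close>

theorem corollary6:
  "\<exists>\<beta>0::real. \<beta>0 > 0 \<and>
     (\<forall>\<^sub>F X::real in at_top.
        (1 / X) * (\<Sum>t | X \<le> real t \<and> real t < 2 * X. d_dens t - nu_dens t) \<ge> \<beta>0 / ln X) \<and>
     lower_density {t. t > 0 \<and> ln (real t) * (d_dens t - nu_dens t) \<ge> \<beta>0 / 2} = 1"
proof -
  \<comment> \<open>The bound holds for every large \<open>t\<close>, so both claims follow from it
    with the constant \<open>c / 4\<close>; the set in the second claim even contains all large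
    \<open>t\<close>.\<close>
  obtain c T where c: "c > 0" and T: "\<And>t. t \<ge> T \<Longrightarrow> c / ln (real t) \<le> d_dens t - nu_dens t"
    using d_dens_minus_nu_dens_ge unfolding eventually_sequentially by blast
  \<comment> \<open>In \<open>c / 4\<close> one factor 2 is lost because the interval is only
    guaranteed \<open>X - 1 \<ge> X / 2\<close> integers, the other because
    \<open>ln t \<le> ln (2 * X) \<le> 2 * ln X\<close>.\<close>
  have "\<forall>\<^sub>F X::real in at_top.
    (1 / X) * (\<Sum>t | X \<le> real t \<and> real t < 2 * X. d_dens t - nu_dens t) \<ge> (c / 4) / ln X"
    using eventually_ge_at_top[of "max 2 (real T)"]
  proof eventually_elim
    case (elim X)
    then have X: "X \<ge> 2" "X \<ge> real T" by auto
    let ?I = "{t. X \<le> real t \<and> real t < 2 * X}"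
    have I: "?I = {nat \<lceil>X\<rceil>..<nat \<lceil>2 * X\<rceil>}"
      using X by (auto simp: nat_ceiling_le_eq nat_less_iff) linarith+
    have "X - 1 \<le> real (card ?I)" unfolding I using X by simp linarith
    then have "X / 2 \<le> real (card ?I)" using X by linarith
    have "ln (2 * X) = ln 2 + ln X" "ln 2 \<le> ln X" "ln X > 0" using X by (simp_all add: ln_mult)
    then have lnX: "ln (2 * X) \<le> 2 * ln X" "ln X > 0" by linarith+
    have "c / (2 * ln X) \<le> d_dens t - nu_dens t" if "t \<in> ?I" for t
    proof -
      have "ln (real t) \<le> ln (2 * X)" "ln (real t) > 0" using that X by auto
      then have "c / (2 * ln X) \<le> c / ln (real t)" using lnX c by (intro divide_left_mono) auto
      also have "\<dots> \<le> d_dens t - nu_dens t" using that X by (intro T) auto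
      finally show ?thesis .
    qed
    then have "real (card ?I) * (c / (2 * ln X)) \<le> (\<Sum>t\<in>?I. d_dens t - nu_dens t)"
      by (rule sum_bounded_below)
    moreover have "X / 2 * (c / (2 * ln X)) \<le> real (card ?I) * (c / (2 * ln X))"
      using \<open>X / 2 \<le> _\<close> c lnX by (intro mult_right_mono) auto
    ultimately have "X / 2 * (c / (2 * ln X)) \<le> (\<Sum>t\<in>?I. d_dens t - nu_dens t)" by linarith
    then have "1 / X * (X / 2 * (c / (2 * ln X))) \<le> 1 / X * (\<Sum>t\<in>?I. d_dens t - nu_dens t)"
      using X by (intro mult_left_mono) auto
    moreover have "1 / X * (X / 2 * (c / (2 * ln X))) = (c / 4) / ln X" using X by simp
    ultimately show ?case by (simp only:)
  qed
  moreover have "lower_density {t. t > 0 \<and> ln (real t) * (d_dens t - nu_dens t) \<ge> (c / 4) / 2} = 1"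
  proof -
    define A where "A = {t. t > 0 \<and> ln (real t) * (d_dens t - nu_dens t) \<ge> (c / 4) / 2}"
    \<comment> \<open>Adding 2 to \<open>T\<close> makes \<open>ln t\<close> positive, so that the
      bound may be multiplied by it.\<close>
    have mem: "t \<in> A" if "t \<ge> T + 2" for t
    proof -
      have "ln (real t) > 0" using that by simp
      then have "c \<le> ln (real t) * (d_dens t - nu_dens t)"
        using T[of t] that by (simp add: field_simps)
      then show ?thesis using that c unfolding A_def by simp
    qed
    have cnt: "x - real (T + 3) \<le> real (count_upto A x)" "real (count_upto A x) \<le> x" if "x \<ge> 0" for x
    proof -
      have sub: "{n \<in> A. 1 \<le> n \<and> real n \<le> x} \<subseteq> {1..nat \<lfloor>x\<rfloor>}" by (auto simp: le_nat_floor)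
      have "{T + 2..nat \<lfloor>x\<rfloor>} \<subseteq> {n \<in> A. 1 \<le> n \<and> real n \<le> x}"
        using that mem by (auto simp: le_nat_iff le_floor_iff)
      then have "card {T + 2..nat \<lfloor>x\<rfloor>} \<le> count_upto A x"
        unfolding count_upto_def by (intro card_mono finite_subset[OF sub]) auto
      then show "x - real (T + 3) \<le> real (count_upto A x)" using that by simp linarith
      have "count_upto A x \<le> nat \<lfloor>x\<rfloor>"
        unfolding count_upto_def using card_mono[OF _ sub] by simp
      then show "real (count_upto A x) \<le> x" using that by linarith
    qed
    have "((\<lambda>x. real (count_upto A x) / x) \<longlongrightarrow> 1) at_top"
    proof (rule tendsto_sandwich)
      show "((\<lambda>x::real. 1 - real (T + 3) / x) \<longlongrightarrow> 1) at_top"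
        by (rule tendsto_eq_intros tendsto_divide_0[OF tendsto_const]
            filterlim_at_top_imp_at_infinity filterlim_ident | simp)+
      show "\<forall>\<^sub>F x in at_top. 1 - real (T + 3) / x \<le> real (count_upto A x) / x"
        using eventually_gt_at_top[of 0]
      proof eventually_elim
        case (elim x)
        then have "(x - real (T + 3)) / x \<le> real (count_upto A x) / x"
          using cnt(1)[of x] by (intro divide_right_mono) auto
        then show ?case using elim by (simp add: diff_divide_distrib)
      qed
      show "\<forall>\<^sub>F x in at_top. real (count_upto A x) / x \<le> 1"
        using eventually_gt_at_top[of 0]
      proof eventually_elim
        case (elim x)
        then show ?case using cnt(2)[of x] by simp
      qed
    qed simp
    then have "((\<lambda>x. ereal (real (count_upto A x) / x)) \<longlongrightarrow> ereal 1) at_top"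
      by (rule tendsto_ereal)
    then show ?thesis
      unfolding lower_density_def A_def[symmetric] one_ereal_def
      by (intro lim_imp_Liminf) auto
  qed
  ultimately show ?thesis using c by (intro exI[of _ "c / 4"]) auto
qed

end
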